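(* Let $\varepsilon>0$ and suppose every item has size at least $\varepsilon$. The following online algorithm is a $(2+\varepsilon,1.7)$-approximation algorithm. Let $g=1/\varepsilon$ and keep for each colour $c$ a counter $w(c)$, initially $0$. When an item $e$ of colour $c$ arrives: if $w(c)\le g$, pack $e$ into the non-isolated bins using First Fit and set $w(c)\leftarrow w(c)+s(e)$; otherwise pack $e$ using First Fit into the isolated bins of colour $c$ (bins containing only items of colour $c$).
   Context: Online coloured bin packing: items arrive one by one, each with size $s(e)\in(0,1]$ and colour $c(e)\in\{1,\dots,m\}$, and must be placed irrevocably into unit-capacity bins. $I_c$ is the set of colour-$c$ items; $\mathrm{OPT}(I)$, $\mathrm{OPT}(I_c)$ are the offline minimum numbers of bins to pack $I$, $I_c$. For the produced packing $P$, $P(I)$ is the number of bins used and $P_c(I)$ the number of bins containing at least one colour-$c$ item. An $(\alpha,\beta)$-approximation algorithm guarantees $P(I)\le\alpha\,\mathrm{OPT}(I)+O(1)$ and $P_c(I)\le\beta\,\mathrm{OPT}(I_c)+O(1)$ for every colour $c$ on every instance, with additive constants independent of the instance (they may depend on $\varepsilon$). First Fit places each item into the earliest-opened bin (among the bins it manages) with room for it, opening a new bin if none has room. *)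

theory Defs
  imports Complex_Main
begin

datatype item = Item (isize: real) (colour: nat)

definition coloured_instance :: "nat \<Rightarrow> item list \<Rightarrow> bool" where
  "coloured_instance m I \<longleftrightarrow>
     (\<forall>e\<in>set I. 0 < isize e \<and> isize e \<le> 1 \<and> colour e \<in> {1..m})"

definition colour_class :: "nat \<Rightarrow> item list \<Rightarrow> item list" where
  "colour_class c I = filter (\<lambda>e. colour e = c) I"

text \<open>
  A packing of the item sequence \<open>I\<close> is the list \<open>P\<close> of the names of the bins chosen for the
  items: \<open>P ! i\<close> is the bin that contains \<open>I ! i\<close>.
\<close>

definition load :: "item list \<Rightarrow> 'b list \<Rightarrow> 'b \<Rightarrow> real" where
  "load I P b = (\<Sum>i | i < length I \<and> P ! i = b. isize (I ! i))"

definition packing :: "item list \<Rightarrow> 'b list \<Rightarrow> bool" where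
  "packing I P \<longleftrightarrow> length P = length I \<and> (\<forall>b\<in>set P. load I P b \<le> 1)"

definition num_bins :: "'b list \<Rightarrow> nat" where
  "num_bins P = card (set P)"

definition num_colour_bins :: "nat \<Rightarrow> item list \<Rightarrow> 'b list \<Rightarrow> nat" where
  "num_colour_bins c I P = card {P ! i | i. i < length I \<and> colour (I ! i) = c}"

text \<open>
  The minimum exists whenever all sizes are at most 1; natural numbers suffice as bin names.
\<close>

definition OPT :: "item list \<Rightarrow> nat" where
  "OPT I = (LEAST k. \<exists>P :: nat list. packing I P \<and> num_bins P = k)"

text \<open>
  An online algorithm is a transition function: from the current state and the arriving item it
  computes the bin receiving the item and the next state. The bin is output immediately and is
  never revised.
\<close>

type_synonym ('s, 'b) online_step = "'s \<Rightarrow> item \<Rightarrow> 'b \<times> 's"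

primrec run :: "('s, 'b) online_step \<Rightarrow> 's \<Rightarrow> item list \<Rightarrow> 'b list" where
  "run step st [] = []"
| "run step st (e # es) = (case step st e of (b, st') \<Rightarrow> b # run step st' es)"

text \<open>
  The set \<open>X\<close> restricts the admissible items. The additive constant is chosen before
  the number of colours, the instance and the colour.
\<close>

definition approximation_algorithm ::
    "('s, 'b) online_step \<Rightarrow> 's \<Rightarrow> item set \<Rightarrow> real \<Rightarrow> real \<Rightarrow> bool" where
  "approximation_algorithm step init X \<alpha> \<beta> \<longleftrightarrow>
     (\<exists>K::real. \<forall>m I. coloured_instance m I \<and> set I \<subseteq> X \<longrightarrow>
        (let P = run step init I in
           packing I P \<and>
           real (num_bins P) \<le> \<alpha> * real (OPT I) + K \<and>
           (\<forall>c\<in>{1..m}.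
              real (num_colour_bins c I P) \<le> \<beta> * real (OPT (colour_class c I)) + K)))"

text \<open>
  A group of bins managed by First Fit is represented by the list of its bin loads, in the
  order in which the bins were opened. The index returned by \<open>first_fit\<close> equals the
  length of the list exactly if no bin has room, so that a new bin has to be opened.
\<close>

primrec first_fit :: "real list \<Rightarrow> real \<Rightarrow> nat" where
  "first_fit [] s = 0"
| "first_fit (l # ls) s = (if l + s \<le> 1 then 0 else Suc (first_fit ls s))"

definition ff_place :: "real list \<Rightarrow> real \<Rightarrow> real list" where
  "ff_place ls s =
     (let i = first_fit ls s in if i < length ls then ls[i := ls ! i + s] else ls @ [s])"

text \<open>
  \<open>Shared i\<close> is the \<open>i\<close>-th non-isolated bin, and \<open>Isolated c i\<close> is the \<open>i\<close>-th
  isolated bin of colour \<open>c\<close>.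
\<close>

datatype bin = Shared nat | Isolated nat nat

record alg_state =
  counter :: "nat \<Rightarrow> real"
  shared_loads :: "real list"
  isolated_loads :: "nat \<Rightarrow> real list"

definition alg_init :: alg_state where
  "alg_init = \<lparr>counter = (\<lambda>_. 0), shared_loads = [], isolated_loads = (\<lambda>_. [])\<rparr>"

definition alg_step :: "real \<Rightarrow> (alg_state, bin) online_step" where
  "alg_step g st e =
     (let c = colour e; s = isize e in
      if counter st c \<le> g
      then (Shared (first_fit (shared_loads st) s),
            st\<lparr>counter := (counter st)(c := counter st c + s),
               shared_loads := ff_place (shared_loads st) s\<rparr>)
      else (Isolated c (first_fit (isolated_loads st c) s),
            st\<lparr>isolated_loads :=
                 (isolated_loads st)(c := ff_place (isolated_loads st c) s)\<rparr>))"

end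

theory Submission
  imports Defs
begin

text \<open>
  In a First Fit group every item of a later bin exceeds the free space of every earlier bin.
  Hence two bins of a group hold more than 1 together, and \<open>n\<close> bins carry total size at least
  \<open>(n - 1) / 2\<close>. Isolated bins of colour \<open>c\<close> exist only once the shared items of colour \<open>c\<close>
  have total size above \<open>1 / \<epsilon>\<close>, so the one bin lost per colour is paid for by \<open>\<epsilon>\<close> times the size
  of those items; this gives \<open>2 + \<epsilon>\<close>. For a single colour, the shared bins containing it are
  boundedly many, because so are the items, and the isolated bins obey the classical factor 1.7 of
  First Fit. The latter is shown with the weight \<open>6/5 x + v(x)\<close> of Dosa and Sgall: a bin of an
  arbitrary packing weighs at most 1.7, while a First Fit bin weighs at least 1 on average, up to
  an additive constant, if the bonus \<open>v\<close> of a bin is credited to the bin preceding it.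
\<close>

section \<open>First Fit weights\<close>

text \<open>The jump to 2/5 lifts a single item above 1/2 to weight at least 6/5 * 1/2 + 2/5 = 1.
  The slope 3/5 is half of 6/5, so that two items of medium size in a later bin make up for the free
  space of an earlier one.\<close>

definition ff_bonus :: "real \<Rightarrow> real" where
  "ff_bonus x = (if x \<le> 1/6 then 0 else if x \<le> 1/3 then 3/5 * (x - 1/6)
     else if x \<le> 1/2 then 1/10 else 2/5)"

definition ff_weight :: "real \<Rightarrow> real" where
  "ff_weight x = 6/5 * x + ff_bonus x"

lemma ff_bonus_nonneg: "0 \<le> ff_bonus x"
  by (auto simp: ff_bonus_def)

lemma ff_weight_nonneg: "0 \<le> x \<Longrightarrow> 0 \<le> ff_weight x"
  using ff_bonus_nonneg[of x] by (simp add: ff_weight_def)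

text \<open>If one part is at most 1/6, its bonus is 0 and monotonicity suffices. If both exceed
  1/6, the bonuses add up to at most 3/5 * (x + y - 1/3) \<le> 1/10, the value at x + y.\<close>

lemma ff_bonus_superadditive:
  assumes "0 \<le> x" "0 \<le> y" "x + y \<le> 1/2"
  shows "ff_bonus x + ff_bonus y \<le> ff_bonus (x + y)"
  using assms by (auto simp: ff_bonus_def field_simps)

lemma sum_ff_bonus_half:
  assumes "finite A" "\<And>i. i \<in> A \<Longrightarrow> 0 \<le> s i" "sum s A \<le> 1/2"
  shows "(\<Sum>i\<in>A. ff_bonus (s i)) \<le> ff_bonus (sum s A)"
  using assms
proof (induction A)
  case empty
  then show ?case by (simp add: ff_bonus_def)
next
  case (insert a A)
  have "0 \<le> s a" "0 \<le> sum s A"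
    using insert.prems by (auto intro: sum_nonneg)
  moreover from this have "sum s A \<le> 1/2"
    using insert.hyps insert.prems(2) by simp
  ultimately show ?case
    using insert ff_bonus_superadditive[of "s a" "sum s A"] by force
qed

lemma sum_ff_bonus_le:
  assumes fin: "finite A" and nn: "\<And>i. i \<in> A \<Longrightarrow> 0 \<le> s i" and le: "sum s A \<le> 1"
  shows "(\<Sum>i\<in>A. ff_bonus (s i)) \<le> 1/2"
proof (cases "\<exists>a\<in>A. s a > 1/2")
  case True
  then obtain a where a: "a \<in> A" "s a > 1/2" by blast
  \<comment> \<open>The items beside \<open>a\<close> can be merged into one item of size at most
    1/2, which leaves a bonus of at most 2/5 + 1/10.\<close>
  have rest: "sum s (A - {a}) \<le> 1/2"
    using a le sum.remove[OF fin a(1), of s] by simp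
  have "(\<Sum>i\<in>A - {a}. ff_bonus (s i)) \<le> ff_bonus (sum s (A - {a}))"
    using fin nn rest by (intro sum_ff_bonus_half) auto
  also have "\<dots> \<le> 1/10"
    using rest by (auto simp: ff_bonus_def)
  finally show ?thesis
    using a sum.remove[OF fin a(1), of "\<lambda>i. ff_bonus (s i)"] by (simp add: ff_bonus_def)
next
  case False
  have "(\<Sum>i\<in>A. ff_bonus (s i)) \<le> (\<Sum>i\<in>A. 3/10 * s i)"
    using nn False by (intro sum_mono) (force simp: ff_bonus_def field_simps)
  also have "\<dots> = 3/10 * sum s A"
    by (simp add: sum_distrib_left)
  finally show ?thesis using le by simp
qed

lemma sum_ff_weight_le:
  assumes "finite A" "\<And>i. i \<in> A \<Longrightarrow> 0 \<le> s i" "sum s A \<le> 1"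
  shows "(\<Sum>i\<in>A. ff_weight (s i)) \<le> 1.7"
  using sum_ff_bonus_le[OF assms] assms(3)
  by (simp add: ff_weight_def sum.distrib sum_distrib_left[symmetric] del: times_divide_eq_left)

section \<open>Bounds for First Fit bins\<close>

text \<open>\<open>B\<close> is the earlier bin. Its final content may be used, since loads only
  grow: an item rejected on arrival would still not fit at the end.\<close>

definition ff_ordered :: "('a \<Rightarrow> real) \<Rightarrow> 'a set \<Rightarrow> 'a set \<Rightarrow> bool" where
  "ff_ordered s B C \<longleftrightarrow> (\<forall>i\<in>C. 1 < sum s B + s i)"

text \<open>Each element pays \<open>f\<close> for itself and \<open>h\<close> for its predecessor,
  and only the last one lacks a successor to help it. The unspent \<open>h\<close> of the head
  strengthens the induction.\<close>

lemma length_le_sum_list_chain: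
  fixes f h :: "'a \<Rightarrow> real"
  assumes "sorted_wrt (\<lambda>x y. 1 \<le> f x + h y) xs" "\<And>x. x \<in> set xs \<Longrightarrow> 0 \<le> f x"
    "\<And>x. x \<in> set xs \<Longrightarrow> 0 \<le> h x"
  shows "real (length xs) \<le> (\<Sum>x\<leftarrow>xs. f x + h x) + 1"
proof -
  have "xs \<noteq> [] \<Longrightarrow> real (length xs) + h (hd xs) \<le> (\<Sum>x\<leftarrow>xs. f x + h x) + 1"
    using assms(1,2)
  proof (induction xs)
    case (Cons x xs)
    then show ?case by (cases xs) force+
  qed simp
  then show ?thesis
    using assms(3)[of "hd xs"] by (cases "xs = []") auto
qed

lemma sorted_wrt_length_le_1:
  assumes "sorted_wrt R xs" "\<And>x y. x \<in> set xs \<Longrightarrow> y \<in> set xs \<Longrightarrow> \<not> R x y"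
  shows "length xs \<le> 1"
proof (cases xs)
  case (Cons x ys)
  then show ?thesis using assms by (cases ys) auto
qed simp

lemma ff_length_le_size:
  assumes ord: "sorted_wrt (ff_ordered s) Bs"
    and fin: "\<And>B. B \<in> set Bs \<Longrightarrow> finite B \<and> B \<noteq> {}"
    and nn: "\<And>B i. B \<in> set Bs \<Longrightarrow> i \<in> B \<Longrightarrow> 0 \<le> s i"
  shows "real (length Bs) \<le> 2 * (\<Sum>B\<leftarrow>Bs. sum s B) + 1"
proof -
  \<comment> \<open>The chain bound is applied with both \<open>f\<close> and \<open>h\<close> equal
    to the load, whence the factor 2.\<close>
  have "sorted_wrt (\<lambda>B C. 1 \<le> sum s B + sum s C) Bs"
  proof (rule sorted_wrt_mono_rel[OF _ ord])
    fix B C assume "B \<in> set Bs" "C \<in> set Bs" and BC: "ff_ordered s B C"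
    then obtain i where "i \<in> C" "finite C" using fin by blast
    moreover from this have "s i \<le> sum s C"
      using nn \<open>C \<in> set Bs\<close> by (intro member_le_sum) auto
    ultimately show "1 \<le> sum s B + sum s C"
      using BC by (auto simp: ff_ordered_def)
  qed
  from length_le_sum_list_chain[OF this] show ?thesis
    using nn by (simp add: sum_nonneg sum_list_const_mult)
qed

section \<open>Number of First Fit bins against their weight\<close>

lemma obtain_two_elements:
  assumes "2 \<le> card C"
  obtains i j where "i \<in> C" "j \<in> C" "i \<noteq> j"
  using assms by (metis One_nat_def Suc_1 card.empty card_le_Suc0_iff_eq card.infinite
      not_less_eq_eq zero_le)

text \<open>Write b for the load of \<open>B\<close>. Items of \<open>C\<close> exceed 1 - b, which
  is at most 1/3, so each has bonus at least 3/5 * (5/6 - b). Two of them give 1 - 6/5 * b, exactly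
  what \<open>B\<close> lacks.\<close>

lemma ff_bonus_pair:
  assumes "ff_ordered s B C" "2/3 \<le> sum s B" "2 \<le> card C"
  shows "1 \<le> 6/5 * sum s B + (\<Sum>i\<in>C. ff_bonus (s i))"
proof -
  obtain i j where ij: "i \<in> C" "j \<in> C" "i \<noteq> j"
    using obtain_two_elements assms(3) by blast
  have "finite C" using assms(3) card.infinite by fastforce
  then have sum: "(\<Sum>k\<in>{i, j}. ff_bonus (s k)) \<le> (\<Sum>k\<in>C. ff_bonus (s k))"
    using ij ff_bonus_nonneg by (intro sum_mono2) auto
  have "3/5 * (1 - sum s B - 1/6) \<le> ff_bonus (s k)" if "k \<in> C" for k
    using that assms(1,2) by (force simp: ff_ordered_def ff_bonus_def field_simps)
  from this[OF ij(1)] this[OF ij(2)] sum ij(3) show ?thesis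
    by simp
qed

text \<open>The bins are split into four classes: one item or several, and large load or not, with
  threshold 1/2 for single items and 2/3 otherwise. Large single items lose nothing and each other
  class loses at most one bin, hence the constant 3.\<close>

lemma ff_length_le_weight:
  assumes ord: "sorted_wrt (ff_ordered s) Bs"
    and fin: "\<And>B. B \<in> set Bs \<Longrightarrow> finite B \<and> B \<noteq> {}"
    and nn: "\<And>B i. B \<in> set Bs \<Longrightarrow> i \<in> B \<Longrightarrow> 0 \<le> s i"
  shows "real (length Bs) \<le> (\<Sum>B\<leftarrow>Bs. \<Sum>i\<in>B. ff_weight (s i)) + 3"
proof -
  define W where "W B = (\<Sum>i\<in>B. ff_weight (s i))" for B
  define single where "single B \<longleftrightarrow> card B = 1" for B :: "'a set"
  define large where "large B \<longleftrightarrow> 1/2 < sum s B" for B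
  define full where "full B \<longleftrightarrow> 2/3 \<le> sum s B" for B
  define F where "F Q R = filter R (filter Q Bs)" for Q R
  note defs = W_def single_def large_def full_def F_def
  have W_alt: "W B = 6/5 * sum s B + (\<Sum>i\<in>B. ff_bonus (s i))" for B
    by (simp add: W_def ff_weight_def sum.distrib sum_distrib_left)
  have F_sorted: "sorted_wrt (ff_ordered s) (F Q R)" for Q R
    unfolding F_def using ord by (intro sorted_wrt_filter)
  have W_nonneg: "0 \<le> (\<Sum>B\<leftarrow>F Q R. W B)" for Q R
    using nn ff_weight_nonneg by (force simp: defs intro!: sum_list_nonneg sum_nonneg)
  have card2: "2 \<le> card B" if "B \<in> set Bs" "\<not> single B" for B
    using that fin[of B] by (cases "card B" rule: nat.exhaust) (auto simp: single_def)
  have split: "sum_list (map f xs) = (\<Sum>B\<leftarrow>filter Q xs. f B) + (\<Sum>B\<leftarrow>filter (Not \<circ> Q) xs. f B)"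
    for f :: "'a set \<Rightarrow> real" and Q xs
    by (induction xs) auto
  have split4: "(\<Sum>B\<leftarrow>Bs. f B) = (\<Sum>B\<leftarrow>F single large. f B) + (\<Sum>B\<leftarrow>F single (Not \<circ> large). f B)
      + (\<Sum>B\<leftarrow>F (Not \<circ> single) full. f B) + (\<Sum>B\<leftarrow>F (Not \<circ> single) (Not \<circ> full). f B)"
    for f :: "'a set \<Rightarrow> real"
    unfolding F_def split[of f Bs single] split[of f "filter single Bs" large]
      split[of f "filter (Not \<circ> single) Bs" full] by simp
  have len: "real (length xs) = (\<Sum>B\<leftarrow>xs. 1)" for xs :: "'a set list"
    by (induction xs) auto
  have "1 \<le> W B" if "B \<in> set (F single large)" for B
  proof -
    obtain i where "B = {i}"
      using \<open>B \<in> _\<close> by (auto simp: defs card_1_singleton_iff)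
    with that show ?thesis
      by (auto simp: defs ff_weight_def ff_bonus_def)
  qed
  then have "real (length (F single large)) \<le> (\<Sum>B\<leftarrow>F single large. W B)"
    unfolding len by (rule sum_list_mono)
  \<comment> \<open>Two items of size at most 1/2 would share a bin.\<close>
  moreover have "length (F single (Not \<circ> large)) \<le> 1"
    using F_sorted
    by (rule sorted_wrt_length_le_1) (force simp: defs ff_ordered_def card_1_singleton_iff)
  \<comment> \<open>After a bin with load below 2/3, a later bin holds only items above 1/3, and two
    of these already make it full.\<close>
  moreover have "length (F (Not \<circ> single) (Not \<circ> full)) \<le> 1"
    using F_sorted
  proof (rule sorted_wrt_length_le_1)
    fix B C
    assume B: "B \<in> set (F (Not \<circ> single) (Not \<circ> full))"
      and C: "C \<in> set (F (Not \<circ> single) (Not \<circ> full))"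
    then have CBs: "C \<in> set Bs" "2 \<le> card C" using card2 by (auto simp: F_def)
    then obtain i j where ij: "i \<in> C" "j \<in> C" "i \<noteq> j" using obtain_two_elements by blast
    have "sum s {i, j} \<le> sum s C"
      using ij fin nn CBs by (intro sum_mono2) auto
    moreover have "sum s B < 2/3" "sum s C < 2/3"
      using B C by (simp_all add: F_def full_def)
    ultimately have "\<not> (1 < sum s B + s i \<and> 1 < sum s B + s j)"
      using ij(3) by simp
    then show "\<not> ff_ordered s B C"
      using ij by (auto simp: ff_ordered_def)
  qed
  moreover have "real (length (F (Not \<circ> single) full)) \<le> (\<Sum>B\<leftarrow>F (Not \<circ> single) full. W B) + 1"
    unfolding W_alt
  proof (rule length_le_sum_list_chain)
    show "sorted_wrt (\<lambda>B C. 1 \<le> 6/5 * sum s B + (\<Sum>i\<in>C. ff_bonus (s i))) (F (Not \<circ> single) full)"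
    proof (rule sorted_wrt_mono_rel[OF _ F_sorted])
      fix B C
      assume "B \<in> set (F (Not \<circ> single) full)" "C \<in> set (F (Not \<circ> single) full)" "ff_ordered s B C"
      then show "1 \<le> 6/5 * sum s B + (\<Sum>i\<in>C. ff_bonus (s i))"
        using card2 by (intro ff_bonus_pair) (simp_all add: F_def full_def)
    qed
  qed (use nn in \<open>auto simp: F_def intro!: sum_nonneg ff_bonus_nonneg mult_nonneg_nonneg\<close>)
  moreover have "real (length Bs) = real (length (F single large)) + real (length (F single (Not \<circ> large)))
      + real (length (F (Not \<circ> single) full)) + real (length (F (Not \<circ> single) (Not \<circ> full)))"
    unfolding len by (rule split4)
  ultimately show ?thesis
    using split4[of W] W_nonneg[of single "Not \<circ> large"]
      W_nonneg[of "Not \<circ> single" "Not \<circ> full"]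
    unfolding W_def[symmetric] by linarith
qed

section \<open>Lower bounds for the optimum\<close>

text \<open>Giving every item its own bin is a packing, so the minimum is attained.\<close>

lemma OPT_packing:
  assumes "\<And>e. e \<in> set I \<Longrightarrow> isize e \<le> 1"
  obtains P :: "nat list" where "packing I P" "num_bins P = OPT I"
proof -
  have "load I [0..<length I] b \<le> 1" if "b < length I" for b
  proof -
    have "{i. i < length I \<and> [0..<length I] ! i = b} = {b}"
      using that by auto
    then show ?thesis
      using assms that by (simp add: load_def)
  qed
  then have "packing I [0..<length I]"
    by (simp add: packing_def)
  then have "\<exists>k. \<exists>P :: nat list. packing I P \<and> num_bins P = k" by blast
  then have "\<exists>P :: nat list. packing I P \<and> num_bins P = OPT I"
    unfolding OPT_def by (rule LeastI_ex)
  with that show thesis by blast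
qed

text \<open>The sum is regrouped by the bins of an optimal packing. It serves both for plain sizes
  with \<alpha> = 1 and for weights with \<alpha> = 1.7.\<close>

lemma sum_sizes_le_OPT:
  fixes f :: "real \<Rightarrow> real"
  assumes size: "\<And>e. e \<in> set I \<Longrightarrow> isize e \<le> 1"
    and bin: "\<And>A. finite A \<Longrightarrow> A \<subseteq> {..<length I} \<Longrightarrow> (\<Sum>i\<in>A. isize (I ! i)) \<le> 1
        \<Longrightarrow> (\<Sum>i\<in>A. f (isize (I ! i))) \<le> \<alpha>"
  shows "(\<Sum>i<length I. f (isize (I ! i))) \<le> \<alpha> * real (OPT I)"
proof -
  obtain P :: "nat list" where P: "packing I P" "num_bins P = OPT I"
    using OPT_packing size by blast
  then have len: "length P = length I" by (simp add: packing_def)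
  have "(\<Sum>i<length I. f (isize (I ! i)))
      = (\<Sum>b\<in>set P. \<Sum>i\<in>{i \<in> {..<length I}. P ! i = b}. f (isize (I ! i)))"
    using len by (intro sum.group[symmetric]) auto
  also have "\<dots> \<le> (\<Sum>b\<in>set P. \<alpha>)"
    using P(1) by (intro sum_mono bin) (auto simp: packing_def load_def)
  finally show ?thesis
    using P(2) by (simp add: num_bins_def mult.commute)
qed

lemma sum_size_le_OPT:
  assumes "\<And>e. e \<in> set I \<Longrightarrow> isize e \<le> 1"
  shows "(\<Sum>i<length I. isize (I ! i)) \<le> real (OPT I)"
  using sum_sizes_le_OPT[OF assms, where f = "\<lambda>x. x" and \<alpha> = 1] by simp

lemma sum_ff_weight_le_OPT:
  assumes "\<And>e. e \<in> set I \<Longrightarrow> 0 \<le> isize e \<and> isize e \<le> 1"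
  shows "(\<Sum>i<length I. ff_weight (isize (I ! i))) \<le> 1.7 * real (OPT I)"
proof (rule sum_sizes_le_OPT)
  show "isize e \<le> 1" if "e \<in> set I" for e
    using assms that by blast
next
  fix A assume "finite A" "A \<subseteq> {..<length I}" "(\<Sum>i\<in>A. isize (I ! i)) \<le> 1"
  then show "(\<Sum>i\<in>A. ff_weight (isize (I ! i))) \<le> 1.7"
    using assms by (intro sum_ff_weight_le) auto
qed

text \<open>Connects the optimum of a colour class, which concerns a filtered list, with positions
  in the whole instance.\<close>

lemma sum_nth_filter:
  fixes f :: "'a \<Rightarrow> real"
  shows "(\<Sum>i<length (filter Q xs). f (filter Q xs ! i)) = (\<Sum>i | i < length xs \<and> Q (xs ! i). f (xs ! i))"
proof -
  have "(\<Sum>i<length (filter Q xs). f (filter Q xs ! i)) = (\<Sum>x\<leftarrow>filter Q xs. f x)"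
    by (simp add: sum_list_sum_nth atLeast0LessThan)
  also have "\<dots> = (\<Sum>x\<leftarrow>xs. if Q x then f x else 0)"
    by (rule sum_list_map_filter')
  also have "\<dots> = (\<Sum>i<length xs. if Q (xs ! i) then f (xs ! i) else 0)"
    by (simp add: sum_list_sum_nth atLeast0LessThan)
  also have "\<dots> = (\<Sum>i | i < length xs \<and> Q (xs ! i). f (xs ! i))"
    by (simp add: sum.If_cases lessThan_def Collect_conj_eq)
  finally show ?thesis .
qed

section \<open>Groups of bins managed by First Fit\<close>

lemma first_fit_le_length: "first_fit ls s \<le> length ls"
  by (induction ls) auto

lemma first_fit_room: "first_fit ls s < length ls \<Longrightarrow> ls ! first_fit ls s + s \<le> 1"
  by (induction ls) auto

lemma first_fit_no_room: "k < first_fit ls s \<Longrightarrow> 1 < ls ! k + s"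
proof (induction ls arbitrary: k)
  case (Cons l ls)
  then show ?case by (cases k) (auto split: if_splits)
qed simp

lemma length_ff_place:
  "length (ff_place ls s) = (if first_fit ls s < length ls then length ls else Suc (length ls))"
  by (simp add: ff_place_def Let_def)

lemma nth_ff_place:
  assumes "k < length (ff_place ls s)"
  shows "ff_place ls s ! k = (if k < length ls then ls ! k else 0) + (if k = first_fit ls s then s else 0)"
  using assms first_fit_le_length[of ls s]
  by (auto simp: ff_place_def Let_def nth_list_update nth_append split: if_splits)

lemma load_snoc:
  assumes "length P = length I"
  shows "load (I @ [e]) (P @ [b]) b' = load I P b' + (if b = b' then isize e else 0)"
proof -
  have eq: "{i. i < length (I @ [e]) \<and> (P @ [b]) ! i = b'}
      = {i. i < length I \<and> P ! i = b'} \<union> (if b = b' then {length I} else {})"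
    using assms by (auto simp: nth_append less_Suc_eq)
  have "load (I @ [e]) (P @ [b]) b'
      = (\<Sum>i\<in>{i. i < length I \<and> P ! i = b'}. isize ((I @ [e]) ! i)) + (if b = b' then isize e else 0)"
    unfolding load_def eq by (auto simp: sum.union_disjoint)
  then show ?thesis
    by (simp add: load_def nth_append)
qed

text \<open>\<open>B k\<close> is the name of the \<open>k\<close>-th bin of the group, and \<open>ls\<close> is its list of bin loads.\<close>

definition ff_group :: "item list \<Rightarrow> 'b list \<Rightarrow> (nat \<Rightarrow> 'b) \<Rightarrow> real list \<Rightarrow> bool" where
  "ff_group I P B ls \<longleftrightarrow>
     (\<forall>k. B k \<in> set P \<longleftrightarrow> k < length ls) \<and>
     (\<forall>k<length ls. ls ! k = load I P (B k) \<and> ls ! k \<le> 1) \<and>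
     (\<forall>j<length I. \<forall>k. P ! j = B k \<longrightarrow> (\<forall>k'<k. 1 < load I P (B k') + isize (I ! j)))"

lemma load_eq_0: "length P = length I \<Longrightarrow> b \<notin> set P \<Longrightarrow> load I P b = 0"
  by (auto simp: load_def intro!: sum.neutral)

text \<open>Older items keep their order property because loads only increase; the new item has it
  because First Fit passed over all earlier bins. A fresh bin had load 0 before, so it receives just
  the size of \<open>e\<close>.\<close>

lemma ff_group_place:
  assumes grp: "ff_group I P B ls" and len: "length P = length I" and inj: "inj B"
    and size: "0 \<le> isize e" "isize e \<le> 1"
  shows "ff_group (I @ [e]) (P @ [B (first_fit ls (isize e))]) B (ff_place ls (isize e))"
proof -
  let ?k = "first_fit ls (isize e)" and ?I = "I @ [e]"
  let ?P = "P @ [B ?k]"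
  have eqB: "B k = B k' \<longleftrightarrow> k = k'" for k k'
    using inj by (simp add: inj_eq)
  have load: "load ?I ?P (B k) = load I P (B k) + (if k = ?k then isize e else 0)" for k
    using len by (auto simp: load_snoc eqB)
  have mem: "B k \<in> set ?P \<longleftrightarrow> k < length (ff_place ls (isize e))" for k
    using grp first_fit_le_length[of ls "isize e"]
    by (auto simp: ff_group_def length_ff_place eqB)
  have "ff_place ls (isize e) ! k = load ?I ?P (B k) \<and> ff_place ls (isize e) ! k \<le> 1"
    if "k < length (ff_place ls (isize e))" for k
  proof (cases "k < length ls")
    case True
    then show ?thesis
      using that grp first_fit_room[of ls "isize e"]
      by (auto simp: nth_ff_place load ff_group_def)
  next
    case False
    then have "load I P (B k) = 0"
      using grp len by (intro load_eq_0) (auto simp: ff_group_def)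
    then show ?thesis
      using that False size by (auto simp: nth_ff_place load)
  qed
  moreover have "1 < load ?I ?P (B k') + isize (?I ! j)"
    if j: "j < length ?I" "?P ! j = B k" and k': "k' < k" for j k k'
  proof (cases "j < length I")
    case True
    then have "1 < load I P (B k') + isize (I ! j)"
      using grp j k' len unfolding ff_group_def by (simp add: nth_append)
    then show ?thesis
      using True size by (auto simp: load nth_append)
  next
    case False
    then have "k = ?k" using j len by (auto simp: nth_append eqB)
    then show ?thesis
      using False j k' grp first_fit_le_length[of ls "isize e"] first_fit_no_room[of k' ls "isize e"]
      by (auto simp: load ff_group_def less_Suc_eq)
  qed
  ultimately show ?thesis
    using mem unfolding ff_group_def by blast
qed

lemma ff_group_other:
  assumes "ff_group I P B ls" "length P = length I" "\<And>k. b \<noteq> B k"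
  shows "ff_group (I @ [e]) (P @ [b]) B ls"
  using assms unfolding ff_group_def
  by (auto simp: load_snoc nth_append less_Suc_eq)

text \<open>Transfers the abstract bounds to a group: its bins become the position sets
  \<open>C k\<close>, which are nonempty, ordered by \<open>ff_ordered\<close>, and partition
  \<open>A\<close>.\<close>

lemma
  assumes grp: "ff_group I P B ls" and len: "length P = length I" and inj: "inj B"
    and nn: "\<And>e. e \<in> set I \<Longrightarrow> 0 \<le> isize e"
  defines "A \<equiv> {i. i < length I \<and> P ! i \<in> range B}"
  shows ff_group_size: "real (length ls) \<le> 2 * (\<Sum>i\<in>A. isize (I ! i)) + 1"
    and ff_group_weight: "real (length ls) \<le> (\<Sum>i\<in>A. ff_weight (isize (I ! i))) + 3"
proof -
  define C where "C k = {i. i < length I \<and> P ! i = B k}" for k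
  define Bs where "Bs = map C [0..<length ls]"
  have "sorted_wrt (ff_ordered (\<lambda>i. isize (I ! i))) Bs"
    unfolding Bs_def sorted_wrt_map
  proof (rule sorted_wrt_mono_rel[OF _ sorted_wrt_upt])
    fix k k' :: nat assume "k < k'"
    then show "ff_ordered (\<lambda>i. isize (I ! i)) (C k) (C k')"
      using grp by (auto simp: ff_ordered_def C_def ff_group_def load_def)
  qed
  moreover have "finite X \<and> X \<noteq> {}" if X: "X \<in> set Bs" for X
  proof -
    obtain k where k: "k < length ls" "X = C k"
      using X by (auto simp: Bs_def)
    then obtain i where "i < length P" "P ! i = B k"
      using grp by (metis ff_group_def in_set_conv_nth)
    with k len show ?thesis by (auto simp: C_def)
  qed
  moreover have "0 \<le> isize (I ! i)" if "X \<in> set Bs" "i \<in> X" for X i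
    using that nn by (auto simp: Bs_def C_def)
  moreover have sums: "(\<Sum>X\<leftarrow>Bs. sum f X) = sum f A" for f :: "nat \<Rightarrow> real"
  proof -
    have "k < length ls" if "i < length I" "P ! i = B k" for i k
      using that grp len by (metis ff_group_def nth_mem)
    then have "A = (\<Union>k\<in>{..<length ls}. C k)"
      by (auto simp: A_def C_def)
    moreover have "sum f (\<Union>k\<in>{..<length ls}. C k) = (\<Sum>k<length ls. sum f (C k))"
      using inj by (intro sum.UNION_disjoint) (auto simp: C_def inj_eq)
    ultimately show ?thesis
      by (simp add: Bs_def comp_def sum_list_sum_nth atLeast0LessThan)
  qed
  ultimately show "real (length ls) \<le> 2 * (\<Sum>i\<in>A. isize (I ! i)) + 1"
    and "real (length ls) \<le> (\<Sum>i\<in>A. ff_weight (isize (I ! i))) + 3"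
    using ff_length_le_size[of "\<lambda>i. isize (I ! i)" Bs] ff_length_le_weight[of "\<lambda>i. isize (I ! i)" Bs]
    by (simp_all add: Bs_def)
qed

section \<open>The algorithm\<close>

text \<open>\<open>run\<close> returns only the bins; induction by appending an item also needs the
  state reached.\<close>

definition final_state :: "('s, 'b) online_step \<Rightarrow> 's \<Rightarrow> item list \<Rightarrow> 's" where
  "final_state step st I = fold (\<lambda>e st. snd (step st e)) I st"

lemma run_snoc: "run step st (I @ [e]) = run step st I @ [fst (step (final_state step st I) e)]"
  by (induction I arbitrary: st) (auto simp: final_state_def split: prod.split)

lemma final_state_snoc: "final_state step st (I @ [e]) = snd (step (final_state step st I) e)"
  by (simp add: final_state_def)

lemma length_run: "length (run step st I) = length I"
  by (induction I arbitrary: st) (auto split: prod.split)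

section \<open>The invariant of a run\<close>

definition shared_items :: "item list \<Rightarrow> bin list \<Rightarrow> nat \<Rightarrow> nat set" where
  "shared_items I P c = {i. i < length I \<and> P ! i \<in> range Shared \<and> colour (I ! i) = c}"

text \<open>The upper bound on the counter limits the shared bins of a colour; the lower bound,
  valid once isolated bins exist, pays for the bin lost in an isolated group.\<close>

definition alg_invariant :: "real \<Rightarrow> item list \<Rightarrow> bin list \<Rightarrow> alg_state \<Rightarrow> bool" where
  "alg_invariant g I P st \<longleftrightarrow>
     length P = length I \<and>
     ff_group I P Shared (shared_loads st) \<and>
     (\<forall>c. ff_group I P (Isolated c) (isolated_loads st c)) \<and>
     (\<forall>i<length I. \<forall>c k. P ! i = Isolated c k \<longrightarrow> colour (I ! i) = c) \<and>
     (\<forall>c. counter st c = (\<Sum>i\<in>shared_items I P c. isize (I ! i))) \<and>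
     (\<forall>c. counter st c \<le> g + 1) \<and>
     (\<forall>c. isolated_loads st c \<noteq> [] \<longrightarrow> g < counter st c)"

lemma shared_items_snoc:
  assumes "length P = length I"
  shows "(\<Sum>i\<in>shared_items (I @ [e]) (P @ [b]) c. isize ((I @ [e]) ! i)) =
    (\<Sum>i\<in>shared_items I P c. isize (I ! i)) + (if b \<in> range Shared \<and> colour e = c then isize e else 0)"
proof -
  have "shared_items (I @ [e]) (P @ [b]) c =
      shared_items I P c \<union> (if b \<in> range Shared \<and> colour e = c then {length I} else {})"
    using assms by (auto simp: shared_items_def nth_append less_Suc_eq split: if_splits)
  moreover have "(\<Sum>i\<in>shared_items I P c. isize ((I @ [e]) ! i)) = (\<Sum>i\<in>shared_items I P c. isize (I ! i))"
    by (intro sum.cong) (auto simp: shared_items_def nth_append)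
  moreover have "finite (shared_items I P c)" "length I \<notin> shared_items I P c"
    by (auto simp: shared_items_def)
  ultimately show ?thesis
    by auto
qed

lemma alg_invariant_step:
  assumes inv: "alg_invariant g I P st" and size: "0 < isize e" "isize e \<le> 1"
    and step: "alg_step g st e = (b, st')"
  shows "alg_invariant g (I @ [e]) (P @ [b]) st'"
proof (cases "counter st (colour e) \<le> g")
  case True
  have len: "length P = length I" using inv by (simp add: alg_invariant_def)
  have b: "b = Shared (first_fit (shared_loads st) (isize e))"
    and st': "st' = st\<lparr>counter := (counter st)(colour e := counter st (colour e) + isize e),
        shared_loads := ff_place (shared_loads st) (isize e)\<rparr>"
    using True step by (auto simp: alg_step_def Let_def)
  have "ff_group (I @ [e]) (P @ [b]) Shared (shared_loads st')"
    using inv size unfolding b st' by (auto simp: alg_invariant_def inj_def intro!: ff_group_place)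
  moreover have "ff_group (I @ [e]) (P @ [b]) (Isolated c) (isolated_loads st' c)" for c
    using inv unfolding b st' by (auto simp: alg_invariant_def intro!: ff_group_other)
  moreover have "\<forall>i<length (I @ [e]). \<forall>c k. (P @ [b]) ! i = Isolated c k \<longrightarrow> colour ((I @ [e]) ! i) = c"
    using inv b len by (auto simp: alg_invariant_def nth_append less_Suc_eq)
  moreover have "counter st' c = (\<Sum>i\<in>shared_items (I @ [e]) (P @ [b]) c. isize ((I @ [e]) ! i))" for c
    unfolding shared_items_snoc[OF len] using inv b st' by (auto simp: alg_invariant_def)
  \<comment> \<open>The counter was at most \<open>g\<close> before this item, whose size is at most
    1.\<close>
  moreover have "counter st' c \<le> g + 1" for c
    using inv True size unfolding st' by (auto simp: alg_invariant_def)
  moreover have "isolated_loads st' c \<noteq> [] \<longrightarrow> g < counter st' c" for c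
    using inv True size unfolding st' by (auto simp: alg_invariant_def)
  ultimately show ?thesis
    using len unfolding alg_invariant_def by simp
next
  case False
  let ?c = "colour e"
  have len: "length P = length I" using inv by (simp add: alg_invariant_def)
  have b: "b = Isolated ?c (first_fit (isolated_loads st ?c) (isize e))"
    and st': "st' = st\<lparr>isolated_loads :=
        (isolated_loads st)(?c := ff_place (isolated_loads st ?c) (isize e))\<rparr>"
    using False step by (auto simp: alg_step_def Let_def)
  have "ff_group (I @ [e]) (P @ [b]) Shared (shared_loads st')"
    using inv unfolding b st' by (auto simp: alg_invariant_def intro!: ff_group_other)
  moreover have "ff_group (I @ [e]) (P @ [b]) (Isolated c) (isolated_loads st' c)" for c
  proof (cases "c = ?c")
    case True
    have "ff_group (I @ [e]) (P @ [b]) (Isolated ?c) (ff_place (isolated_loads st ?c) (isize e))"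
      unfolding b using inv size by (intro ff_group_place) (auto simp: alg_invariant_def inj_def)
    then show ?thesis using True by (simp add: st')
  next
    case False
    then show ?thesis
      using inv unfolding b st' by (auto simp: alg_invariant_def intro!: ff_group_other)
  qed
  moreover have "\<forall>i<length (I @ [e]). \<forall>c k. (P @ [b]) ! i = Isolated c k \<longrightarrow> colour ((I @ [e]) ! i) = c"
    using inv b len by (auto simp: alg_invariant_def nth_append less_Suc_eq)
  moreover have "counter st' c = (\<Sum>i\<in>shared_items (I @ [e]) (P @ [b]) c. isize ((I @ [e]) ! i))" for c
    unfolding shared_items_snoc[OF len] using inv b st' by (auto simp: alg_invariant_def)
  moreover have "counter st' c \<le> g + 1" for c
    using inv unfolding st' by (auto simp: alg_invariant_def)
  \<comment> \<open>An isolated group is opened only in this branch, where the counter already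
    exceeds \<open>g\<close>.\<close>
  moreover have "isolated_loads st' c \<noteq> [] \<longrightarrow> g < counter st' c" for c
    using inv False unfolding st' by (auto simp: alg_invariant_def)
  ultimately show ?thesis
    using len unfolding alg_invariant_def by simp
qed

lemma alg_invariant_run:
  assumes "\<And>e. e \<in> set I \<Longrightarrow> 0 < isize e \<and> isize e \<le> 1" "0 \<le> g"
  shows "alg_invariant g I (run (alg_step g) alg_init I) (final_state (alg_step g) alg_init I)"
  using assms
proof (induction I rule: rev_induct)
  case Nil
  then show ?case
    by (simp add: alg_invariant_def ff_group_def final_state_def alg_init_def shared_items_def)
next
  case (snoc e I)
  then show ?case
    unfolding run_snoc final_state_snoc by (intro alg_invariant_step) auto
qed

section \<open>Feasibility and the two bounds from the invariant\<close>

lemma alg_invariant_packing: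
  assumes "alg_invariant g I P st"
  shows "packing I P"
proof -
  have "load I P b \<le> 1" if "b \<in> set P" for b
  proof (cases b)
    case (Shared k)
    then show ?thesis
      using assms that unfolding alg_invariant_def ff_group_def by metis
  next
    case (Isolated c k)
    then show ?thesis
      using assms that unfolding alg_invariant_def ff_group_def by metis
  qed
  then show ?thesis
    using assms by (simp add: packing_def alg_invariant_def)
qed

lemma alg_invariant_num_bins:
  assumes inv: "alg_invariant (1 / \<epsilon>) I P st" and inst: "coloured_instance m I" and "0 < \<epsilon>"
  shows "real (num_bins P) \<le> (2 + \<epsilon>) * real (OPT I) + 1"
proof -
  define s where "s i = isize (I ! i)" for i
  define n where "n c = length (isolated_loads st c)" for c
  define S where "S = {i. i < length I \<and> P ! i \<in> range Shared}"
  define T where "T c = {i. i < length I \<and> P ! i \<in> range (Isolated c)}" for c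
  note inst' = inst[unfolded coloured_instance_def]
  have len: "length P = length I" using inv by (simp add: alg_invariant_def)
  have nn: "\<And>e. e \<in> set I \<Longrightarrow> 0 \<le> isize e"
    using inst' by (auto intro: less_imp_le)
  have s_nn: "0 \<le> s i" if "i < length I" for i
    using that nn by (simp add: s_def)
  have col: "colour (I ! i) \<in> {1..m}" if "i < length I" for i
    using that inst' by simp
  have iso_col: "c \<in> {1..m}" if mem: "Isolated c k \<in> set P" for c k
  proof -
    obtain i where "i < length I" "P ! i = Isolated c k"
      using mem len by (auto simp: in_set_conv_nth)
    then show ?thesis
      using col[of i] inv by (auto simp: alg_invariant_def)
  qed
  have "set P \<subseteq> Shared ` {..<length (shared_loads st)} \<union> (\<Union>c\<in>{1..m}. Isolated c ` {..<n c})"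
  proof
    fix b assume b: "b \<in> set P"
    show "b \<in> Shared ` {..<length (shared_loads st)} \<union> (\<Union>c\<in>{1..m}. Isolated c ` {..<n c})"
    proof (cases b)
      case (Shared k)
      then have "k < length (shared_loads st)"
        using b inv by (auto simp: alg_invariant_def ff_group_def)
      then show ?thesis using Shared by blast
    next
      case (Isolated c k)
      then have "k < n c"
        using b inv by (auto simp: alg_invariant_def ff_group_def n_def)
      moreover have "c \<in> {1..m}" using Isolated b iso_col by blast
      ultimately show ?thesis using Isolated by blast
    qed
  qed
  then have "card (set P) \<le> card (Shared ` {..<length (shared_loads st)} \<union> (\<Union>c\<in>{1..m}. Isolated c ` {..<n c}))"
    by (intro card_mono) auto
  also have "\<dots> \<le> card (Shared ` {..<length (shared_loads st)}) + (\<Sum>c=1..m. card (Isolated c ` {..<n c}))"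
    by (intro order_trans[OF card_Un_le] add_mono card_UN_le) auto
  also have "\<dots> = length (shared_loads st) + (\<Sum>c=1..m. n c)"
    by (simp add: card_image inj_on_def)
  finally have "real (num_bins P) \<le> real (length (shared_loads st)) + (\<Sum>c=1..m. real (n c))"
    unfolding num_bins_def using of_nat_mono by fastforce
  moreover have "real (length (shared_loads st)) \<le> 2 * sum s S + 1"
    unfolding s_def S_def using inv len nn
    by (intro ff_group_size) (auto simp: alg_invariant_def inj_def)
  \<comment> \<open>Charging the lost bin of each colour to its shared items keeps the additive
    constant independent of \<open>m\<close>; a colour without isolated bins has nothing to
    pay.\<close>
  moreover have "real (n c) \<le> 2 * sum s (T c) + \<epsilon> * sum s (shared_items I P c)" for c
  proof (cases "n c = 0")
    case True
    have "0 \<le> sum s (T c)" "0 \<le> sum s (shared_items I P c)"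
      using s_nn by (auto simp: T_def shared_items_def intro!: sum_nonneg)
    then show ?thesis using True \<open>0 < \<epsilon>\<close> by simp
  next
    case False
    then have "1 / \<epsilon> < sum s (shared_items I P c)"
      using inv by (auto simp: alg_invariant_def n_def s_def)
    then have "1 \<le> \<epsilon> * sum s (shared_items I P c)"
      using \<open>0 < \<epsilon>\<close> by (simp add: field_simps)
    moreover have "real (n c) \<le> 2 * sum s (T c) + 1"
      unfolding s_def T_def n_def using inv len nn
      by (intro ff_group_size) (auto simp: alg_invariant_def inj_def)
    ultimately show ?thesis by simp
  qed
  then have "(\<Sum>c=1..m. real (n c)) \<le> (\<Sum>c=1..m. 2 * sum s (T c) + \<epsilon> * sum s (shared_items I P c))"
    by (rule sum_mono)
  moreover have "(\<Sum>c=1..m. sum s (shared_items I P c)) = sum s S"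
  proof -
    have "shared_items I P c = {i \<in> S. colour (I ! i) = c}" for c
      by (auto simp: shared_items_def S_def)
    moreover have "(\<Sum>c=1..m. sum s {i \<in> S. colour (I ! i) = c}) = sum s S"
      using col by (intro sum.group) (auto simp: S_def)
    ultimately show ?thesis by simp
  qed
  moreover have "(\<Sum>c=1..m. sum s (T c)) = sum s ({..<length I} - S)"
  proof -
    have "{..<length I} - S = (\<Union>c\<in>{1..m}. T c)"
    proof -
      have "i \<in> (\<Union>c\<in>{1..m}. T c)" if "i \<in> {..<length I} - S" for i
      proof (cases "P ! i")
        case (Isolated c k)
        then show ?thesis
          using that iso_col[of c k] len by (force simp: T_def in_set_conv_nth)
      qed (use that in \<open>auto simp: S_def\<close>)
      then show ?thesis by (auto simp: S_def T_def)
    qed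
    moreover have "sum s (\<Union>c\<in>{1..m}. T c) = (\<Sum>c=1..m. sum s (T c))"
      by (intro sum.UNION_disjoint) (auto simp: T_def)
    ultimately show ?thesis by simp
  qed
  ultimately have "real (num_bins P) \<le> 2 * (sum s S + sum s ({..<length I} - S)) + \<epsilon> * sum s S + 1"
    by (simp add: sum.distrib flip: sum_distrib_left)
  also have "sum s S + sum s ({..<length I} - S) = sum s {..<length I}"
    by (subst sum.subset_diff[of S "{..<length I}"]) (auto simp: S_def)
  also have "2 * sum s {..<length I} + \<epsilon> * sum s S + 1 \<le> (2 + \<epsilon>) * sum s {..<length I} + 1"
  proof -
    have "sum s S \<le> sum s {..<length I}"
      using s_nn by (intro sum_mono2) (auto simp: S_def)
    then show ?thesis
      using \<open>0 < \<epsilon>\<close> by (simp add: distrib_right mult_left_mono)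
  qed
  also have "\<dots> \<le> (2 + \<epsilon>) * real (OPT I) + 1"
    using \<open>0 < \<epsilon>\<close> inst' unfolding s_def
    by (intro add_mono mult_left_mono sum_size_le_OPT) auto
  finally show ?thesis by simp
qed

text \<open>Shared bins are counted crudely, one per shared item: with sizes at least \<epsilon> and
  total size at most g + 1 there are at most (g + 1) / \<epsilon>. Only the isolated bins need the
  weight argument.\<close>

lemma alg_invariant_num_colour_bins:
  assumes inv: "alg_invariant g I P st" and inst: "coloured_instance m I"
    and "0 < \<epsilon>" and large: "\<And>e. e \<in> set I \<Longrightarrow> \<epsilon> \<le> isize e"
  shows "real (num_colour_bins c I P) \<le> 1.7 * real (OPT (colour_class c I)) + ((g + 1) / \<epsilon> + 3)"
proof -
  define n where "n = length (isolated_loads st c)"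
  define T where "T = {i. i < length I \<and> P ! i \<in> range (Isolated c)}"
  note inst' = inst[unfolded coloured_instance_def]
  have len: "length P = length I" using inv by (simp add: alg_invariant_def)
  have nn: "0 \<le> isize e" if "e \<in> set I" for e
    using inst' that by (auto intro: less_imp_le)
  have fin: "finite (shared_items I P c)" by (simp add: shared_items_def)
  have "{P ! i | i. i < length I \<and> colour (I ! i) = c}
      \<subseteq> (!) P ` shared_items I P c \<union> Isolated c ` {..<n}"
  proof
    fix b assume "b \<in> {P ! i | i. i < length I \<and> colour (I ! i) = c}"
    then obtain i where i: "b = P ! i" "i < length I" "colour (I ! i) = c" by blast
    then have "b \<in> set P" using len by simp
    show "b \<in> (!) P ` shared_items I P c \<union> Isolated c ` {..<n}"
    proof (cases b)
      case (Shared k)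
      then have "i \<in> shared_items I P c" using i by (simp add: shared_items_def)
      then show ?thesis using i by blast
    next
      case (Isolated c' k)
      then have "c' = c" using i inv by (auto simp: alg_invariant_def)
      then show ?thesis
        using Isolated \<open>b \<in> set P\<close> inv by (auto simp: alg_invariant_def ff_group_def n_def)
    qed
  qed
  then have "num_colour_bins c I P \<le> card ((!) P ` shared_items I P c \<union> Isolated c ` {..<n})"
    unfolding num_colour_bins_def using fin by (intro card_mono) auto
  also have "\<dots> \<le> card ((!) P ` shared_items I P c) + card (Isolated c ` {..<n})"
    by (rule card_Un_le)
  also have "\<dots> \<le> card (shared_items I P c) + n"
    using card_image_le[OF fin] card_image_le[of "{..<n}" "Isolated c"] by (intro add_mono) auto
  finally have "real (num_colour_bins c I P) \<le> real (card (shared_items I P c)) + real n"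
    by linarith
  moreover have "real (card (shared_items I P c)) \<le> (g + 1) / \<epsilon>"
  proof -
    have "real (card (shared_items I P c)) * \<epsilon> \<le> (\<Sum>i\<in>shared_items I P c. isize (I ! i))"
      using large by (intro sum_bounded_below) (auto simp: shared_items_def)
    also have "\<dots> \<le> g + 1"
    proof -
      have "counter st c = (\<Sum>i\<in>shared_items I P c. isize (I ! i))" "counter st c \<le> g + 1"
        using inv unfolding alg_invariant_def by blast+
      then show ?thesis by simp
    qed
    finally show ?thesis using \<open>0 < \<epsilon>\<close> by (simp add: field_simps)
  qed
  moreover have "real n \<le> (\<Sum>i\<in>T. ff_weight (isize (I ! i))) + 3"
    unfolding n_def T_def using inv len nn
    by (intro ff_group_weight) (auto simp: alg_invariant_def inj_def)
  \<comment> \<open>Isolated bins of colour \<open>c\<close> hold only items of that colour, and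
    weights are nonnegative.\<close>
  moreover have "(\<Sum>i\<in>T. ff_weight (isize (I ! i)))
      \<le> (\<Sum>i | i < length I \<and> colour (I ! i) = c. ff_weight (isize (I ! i)))"
    using inv nn by (intro sum_mono2) (auto simp: T_def alg_invariant_def intro!: ff_weight_nonneg)
  moreover have "\<dots> = (\<Sum>i<length (colour_class c I). ff_weight (isize (colour_class c I ! i)))"
    unfolding colour_class_def by (rule sum_nth_filter[symmetric])
  moreover have "\<dots> \<le> 1.7 * real (OPT (colour_class c I))"
    using nn inst' by (intro sum_ff_weight_le_OPT) (auto simp: colour_class_def)
  ultimately show ?thesis by linarith
qed

theorem theorem7:
  fixes \<epsilon> :: real
  assumes "\<epsilon> > 0"
  shows "approximation_algorithm (alg_step (1 / \<epsilon>)) alg_init {e. isize e \<ge> \<epsilon>} (2 + \<epsilon>) 1.7"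
  unfolding approximation_algorithm_def
\<comment> \<open>The additive constant stays schematic until the last \<open>show\<close> fixes it
  to the larger constant, that of the colour bound with g = 1 / \<epsilon>; the total count needs
  only 1.\<close>
proof (intro exI allI impI)
  fix m I
  assume I: "coloured_instance m I \<and> set I \<subseteq> {e. \<epsilon> \<le> isize e}"
  let ?P = "run (alg_step (1 / \<epsilon>)) alg_init I"
  have inv: "alg_invariant (1 / \<epsilon>) I ?P (final_state (alg_step (1 / \<epsilon>)) alg_init I)"
    using I assms by (intro alg_invariant_run) (auto simp: coloured_instance_def)
  have "0 \<le> (1 / \<epsilon> + 1) / \<epsilon>"
    using assms by simp
  then have "real (num_bins ?P) \<le> (2 + \<epsilon>) * real (OPT I) + ((1 / \<epsilon> + 1) / \<epsilon> + 3)"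
    using alg_invariant_num_bins[OF inv conjunct1[OF I] assms] by linarith
  moreover have "real (num_colour_bins c I ?P)
      \<le> 1.7 * real (OPT (colour_class c I)) + ((1 / \<epsilon> + 1) / \<epsilon> + 3)" for c
    using I assms by (intro alg_invariant_num_colour_bins[OF inv]) auto
  ultimately show "let P = ?P in packing I P \<and>
      real (num_bins P) \<le> (2 + \<epsilon>) * real (OPT I) + ((1 / \<epsilon> + 1) / \<epsilon> + 3) \<and>
      (\<forall>c\<in>{1..m}. real (num_colour_bins c I P)
         \<le> 1.7 * real (OPT (colour_class c I)) + ((1 / \<epsilon> + 1) / \<epsilon> + 3))"
    using alg_invariant_packing[OF inv] by (simp add: Let_def)
qed

end
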